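(* Let $\kappa_1,\kappa_2\ge0$ be not both zero, let $\varpi>0$ be the detection constant ($\varpi=1$ for heterodyne, $\varpi=\frac{e}{2\pi}$ for IM/DD), and let the electrical and optical hop SNRs be $\gamma_1=\mu_1X$ and $\gamma_2=\mu_rZ$, where $X,Z$ are independent, almost surely strictly positive random variables (the normalized fading of the two channels) whose laws do not depend on $\mu_1,\mu_r>0$, with $\mathbb{E}[X]<\infty$. Let the end-to-end signal-to-noise-plus-distortion ratio $\gamma$ be $$\gamma=\frac{\gamma_1\gamma_2}{(\kappa_1^2+\kappa_2^2+\kappa_1^2\kappa_2^2)\gamma_1\gamma_2+(1+\kappa_2^2)\gamma_2+C},\quad C=\mathbb{E}[\gamma_1](1+\kappa_1^2)+1,$$ for amplify-and-forward (AF) relaying, and $$\gamma=\min\left(\frac{\gamma_1}{\kappa_1^2\gamma_1+1},\frac{\gamma_2}{\kappa_2^2\gamma_2+1}\right)$$ for decode-and-forward (DF) relaying. Then, as $\mu_1,\mu_r\to\infty$, the ergodic capacity $\overline{C}=\mathbb{E}[\log_2(1+\varpi\gamma)]$ converges to the capacity ceiling $$\overline{C^*}=\log_2(1+\varpi\gamma^* ),\qquad \gamma^*=\begin{cases}\dfrac{1}{\kappa_1^2+\kappa_2^2+\kappa_1^2\kappa_2^2}&\text{for AF relaying},\\[2ex]\dfrac{1}{\max(\kappa_1^2,\kappa_2^2)}&\text{for DF relaying}.\end{cases}$$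
   Context: $\kappa_1$ and $\kappa_2$ are the hardware impairment levels at the source and at the relay. $\mu_1$ is the average SNR of the first (RF) hop and $\mu_r$ the average electrical SNR of the second (optical) hop; in the paper $\gamma_1=|h|^2\mu_1$ with $h$ the RF fading amplitude, and $\gamma_2=\mu_r(I/\mathbb{E}[I])^r$ with $I$ the optical channel gain and $r\in\{1,2\}$ the detection type. The limit $\mu_1,\mu_r\to\infty$ means that both parameters tend to infinity. *)

theory Defs
  imports "HOL-Probability.Probability"
begin

datatype relaying = AF | DF

text \<open>The hop SNRs are passed as random variables on the measure space, not as values, because the
  constant \<open>C\<close> of AF relaying involves the mean of the first one.\<close>

fun sndr :: "relaying \<Rightarrow> 'a measure \<Rightarrow> real \<Rightarrow> real \<Rightarrow> ('a \<Rightarrow> real) \<Rightarrow> ('a \<Rightarrow> real) \<Rightarrow> 'a \<Rightarrow> real"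
  where
    "sndr AF M \<kappa>\<^sub>1 \<kappa>\<^sub>2 \<gamma>\<^sub>1 \<gamma>\<^sub>2 \<omega> =
       (let C = (LINT \<omega>'|M. \<gamma>\<^sub>1 \<omega>') * (1 + \<kappa>\<^sub>1\<^sup>2) + 1
        in \<gamma>\<^sub>1 \<omega> * \<gamma>\<^sub>2 \<omega> /
           ((\<kappa>\<^sub>1\<^sup>2 + \<kappa>\<^sub>2\<^sup>2 + \<kappa>\<^sub>1\<^sup>2 * \<kappa>\<^sub>2\<^sup>2) * \<gamma>\<^sub>1 \<omega> * \<gamma>\<^sub>2 \<omega> + (1 + \<kappa>\<^sub>2\<^sup>2) * \<gamma>\<^sub>2 \<omega> + C))"
  | "sndr DF M \<kappa>\<^sub>1 \<kappa>\<^sub>2 \<gamma>\<^sub>1 \<gamma>\<^sub>2 \<omega> =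
       min (\<gamma>\<^sub>1 \<omega> / (\<kappa>\<^sub>1\<^sup>2 * \<gamma>\<^sub>1 \<omega> + 1)) (\<gamma>\<^sub>2 \<omega> / (\<kappa>\<^sub>2\<^sup>2 * \<gamma>\<^sub>2 \<omega> + 1))"

fun sndr_ceiling :: "relaying \<Rightarrow> real \<Rightarrow> real \<Rightarrow> real"
  where
    "sndr_ceiling AF \<kappa>\<^sub>1 \<kappa>\<^sub>2 = 1 / (\<kappa>\<^sub>1\<^sup>2 + \<kappa>\<^sub>2\<^sup>2 + \<kappa>\<^sub>1\<^sup>2 * \<kappa>\<^sub>2\<^sup>2)"
  | "sndr_ceiling DF \<kappa>\<^sub>1 \<kappa>\<^sub>2 = 1 / max (\<kappa>\<^sub>1\<^sup>2) (\<kappa>\<^sub>2\<^sup>2)"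

text \<open>The Bochner integral is \<open>0\<close> for a non-integrable integrand, so this is the expected value
  only where the integrand is integrable.\<close>

definition ergodic_capacity :: "'a measure \<Rightarrow> real \<Rightarrow> ('a \<Rightarrow> real) \<Rightarrow> real"
  where "ergodic_capacity M varpi \<gamma> = (LINT \<omega>|M. log 2 (1 + varpi * \<gamma> \<omega>))"

definition capacity_ceiling :: "relaying \<Rightarrow> real \<Rightarrow> real \<Rightarrow> real \<Rightarrow> real"
  where "capacity_ceiling R varpi \<kappa>\<^sub>1 \<kappa>\<^sub>2 = log 2 (1 + varpi * sndr_ceiling R \<kappa>\<^sub>1 \<kappa>\<^sub>2)"

end

(* The SNDR is gamma = 1 / D with a denominator D that decreases in both mean SNRs and tends to
   1 / gamma* almost surely. Hence gamma increases to its ceiling, which bounds the integrand. As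
   the capacity is monotone in both parameters, it lies between its value at
   (t, t), t = min mu1 mur, and the ceiling, so dominated convergence along the diagonal gives the
   limit along the product filter. *)
theory Submission imports Defs "HOL-Real_Asymp.Real_Asymp" begin

text \<open>Turns a limit along the diagonal into one along the product filter: a function of
  \<open>min a b\<close> inherits the limit that it has at infinity.\<close>

lemma filterlim_min_at_top_prod:
  "filterlim (\<lambda>(a, b). min a b) at_top (at_top \<times>\<^sub>F (at_top :: 'a :: linorder filter))"
  unfolding filterlim_at_top
proof
  fix c :: 'a
  show "\<forall>\<^sub>F p in at_top \<times>\<^sub>F at_top. c \<le> (case p of (a, b) \<Rightarrow> min a b)"
    using eventually_prodI[OF eventually_ge_at_top[of c] eventually_ge_at_top[of c]]
    by (rule eventually_mono) auto
qed

text \<open>Isolates what AF and DF share, so that each mode only has to supply its denominator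
  \<open>D\<close> and the limit \<open>L\<close>. The relations between \<open>g\<close> and
  \<open>D\<close> are almost sure because the fading is positive only almost surely.\<close>

lemma ergodic_capacity_tendsto_ceiling:
  fixes g D :: "real \<Rightarrow> real \<Rightarrow> 'a \<Rightarrow> real"
  assumes "prob_space M" and w: "w > 0" and L: "L > 0"
    and meas: "\<And>a b. g a b \<in> borel_measurable M"
    and gD: "\<And>a b. a > 0 \<Longrightarrow> b > 0 \<Longrightarrow> AE \<omega> in M. g a b \<omega> = 1 / D a b \<omega>"
    and ge: "\<And>a b. a > 0 \<Longrightarrow> b > 0 \<Longrightarrow> AE \<omega> in M. L \<le> D a b \<omega>"
    and anti: "\<And>a b a' b'. 0 < a \<Longrightarrow> a \<le> a' \<Longrightarrow> 0 < b \<Longrightarrow> b \<le> b'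
                 \<Longrightarrow> AE \<omega> in M. D a' b' \<omega> \<le> D a b \<omega>"
    and lim: "AE \<omega> in M. ((\<lambda>t. D t t \<omega>) \<longlongrightarrow> L) at_top"
  shows "\<And>a b. a > 0 \<Longrightarrow> b > 0 \<Longrightarrow> integrable M (\<lambda>\<omega>. log 2 (1 + w * g a b \<omega>))"
    and "((\<lambda>(a, b). ergodic_capacity M w (g a b)) \<longlongrightarrow> log 2 (1 + w * (1 / L)))
           (at_top \<times>\<^sub>F at_top)"
proof -
  interpret prob_space M by fact
  \<comment> \<open>The value of the integrand at \<open>D = L\<close>. It serves as pointwise
    limit, as uniform upper bound and as dominating constant.\<close>
  define c where "c = log 2 (1 + w * (1 / L))"
  define h where "h a b \<omega> = log 2 (1 + w * (1 / D a b \<omega>))" for a b \<omega>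
  have hg: "AE \<omega> in M. log 2 (1 + w * g a b \<omega>) = h a b \<omega>" if "a > 0" "b > 0" for a b
    using gD[OF that] by eventually_elim (simp add: h_def)
  \<comment> \<open>The integrand decreases in the denominator. Inside this proof
    \<open>log_mono\<close> still means the library fact; afterwards it means the local one.\<close>
  have log_mono: "log 2 (1 + w * (1 / v)) \<le> log 2 (1 + w * (1 / u))" if "0 < u" "u \<le> v" for u v
    using that w by (intro log_mono add_left_mono mult_left_mono divide_left_mono)
      (auto intro!: add_pos_pos)
  have bound: "AE \<omega> in M. 0 \<le> h a b \<omega> \<and> h a b \<omega> \<le> c" if "a > 0" "b > 0" for a b
    using ge[OF that]
  proof eventually_elim
    case (elim \<omega>)
    then have "0 < D a b \<omega>"
      using L by linarith
    moreover from this have "0 \<le> h a b \<omega>"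
      using w by (simp add: h_def zero_le_log_cancel_iff add_pos_nonneg)
    ultimately show ?case
      using elim L log_mono[of L "D a b \<omega>"] by (auto simp: h_def c_def)
  qed
  have [measurable]: "(\<lambda>\<omega>. log 2 (1 + w * g a b \<omega>)) \<in> borel_measurable M" for a b
    using meas[of a b] by measurable
  \<comment> \<open>A bounded measurable function is integrable on a probability space. This rules
    out the default value 0 of the integral and permits the comparisons of integrals below.\<close>
  show int: "integrable M (\<lambda>\<omega>. log 2 (1 + w * g a b \<omega>))" if "a > 0" "b > 0" for a b
  proof (rule integrable_const_bound[where B = c])
    show "AE \<omega> in M. norm (log 2 (1 + w * g a b \<omega>)) \<le> c"
      using hg[OF that] bound[OF that] by eventually_elim auto
  qed measurable
  have diag: "((\<lambda>t. ergodic_capacity M w (g t t)) \<longlongrightarrow> c) at_top"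
  proof -
    \<comment> \<open>On the diagonal \<open>g\<close> equals \<open>1 / D\<close> only outside a null set that depends on \<open>t\<close>, so pointwise
       convergence is only available along sequences.\<close>
    have "(\<lambda>n. ergodic_capacity M w (g (T n) (T n))) \<longlonglongrightarrow> c"
      if T: "filterlim T at_top sequentially" for T :: "nat \<Rightarrow> real"
    proof -
      obtain N where N: "T n > 0" if "n \<ge> N" for n
        using T[unfolded filterlim_at_top_dense] by (auto simp: eventually_sequentially)
      \<comment> \<open>Dropping the first \<open>N\<close> terms makes the parameter positive at
        every index, so that the exceptional null sets of all indices can be merged;
        \<open>LIMSEQ_offset\<close> undoes the shift.\<close>
      let ?T = "\<lambda>n. T (n + N)"
      have pos: "?T n > 0" for n
        by (rule N) simp
      have T': "filterlim ?T at_top sequentially"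
        using T by (rule filterlim_compose) (rule filterlim_add_const_nat_at_top)
      have eq: "AE \<omega> in M. \<forall>n. log 2 (1 + w * g (?T n) (?T n) \<omega>) = h (?T n) (?T n) \<omega>"
        using hg[OF pos pos] by (simp add: AE_all_countable)
      have "(\<lambda>n. LINT \<omega>|M. log 2 (1 + w * g (?T n) (?T n) \<omega>)) \<longlonglongrightarrow> (LINT \<omega>|M. c)"
      proof (rule integral_dominated_convergence[where w = "\<lambda>_. c"])
        show "AE \<omega> in M. (\<lambda>n. log 2 (1 + w * g (?T n) (?T n) \<omega>)) \<longlonglongrightarrow> c"
          using eq lim
        proof eventually_elim
          case (elim \<omega>)
          have "0 < 1 + w * (1 / L)"
            using w L by (simp add: add_pos_pos)
          then have "(\<lambda>n. h (?T n) (?T n) \<omega>) \<longlonglongrightarrow> c"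
            unfolding h_def c_def using L
            by (intro tendsto_intros filterlim_compose[OF elim(2) T']) auto
          then show ?case
            using elim(1) by simp
        qed
        show "AE \<omega> in M. norm (log 2 (1 + w * g (?T n) (?T n) \<omega>)) \<le> c" for n
          using hg[OF pos[of n] pos[of n]] bound[OF pos[of n] pos[of n]] by eventually_elim auto
      qed auto
      then have "(\<lambda>n. ergodic_capacity M w (g (?T n) (?T n))) \<longlonglongrightarrow> c"
        by (simp add: ergodic_capacity_def prob_space)
      then show ?thesis
        by (rule LIMSEQ_offset)
    qed
    then show ?thesis
      by (intro tendsto_at_topI_sequentially)
  qed
  have pos: "\<forall>\<^sub>F p in at_top \<times>\<^sub>F at_top. 0 < (fst p :: real) \<and> 0 < (snd p :: real)"
    using eventually_prodI[OF eventually_gt_at_top[of "0::real"] eventually_gt_at_top[of "0::real"]] .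
  show "((\<lambda>(a, b). ergodic_capacity M w (g a b)) \<longlongrightarrow> log 2 (1 + w * (1 / L)))
          (at_top \<times>\<^sub>F at_top)"
    unfolding c_def[symmetric]
  proof (rule tendsto_sandwich[OF _ _ _ tendsto_const])
    \<comment> \<open>The lower bound is left as an unreduced composition, so that it unifies with
      the conclusion of \<open>filterlim_compose\<close>.\<close>
    show "((\<lambda>p. (\<lambda>t. ergodic_capacity M w (g t t)) (case p of (a, b) \<Rightarrow> min a b)) \<longlongrightarrow> c)
            (at_top \<times>\<^sub>F at_top)"
      using diag filterlim_min_at_top_prod by (rule filterlim_compose)
    show "\<forall>\<^sub>F p in at_top \<times>\<^sub>F at_top. (\<lambda>t. ergodic_capacity M w (g t t)) (case p of (a, b) \<Rightarrow> min a b)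
            \<le> (case p of (a, b) \<Rightarrow> ergodic_capacity M w (g a b))"
      using pos
    proof eventually_elim
      case (elim p)
      obtain a b where p: "p = (a, b)"
        by (cases p)
      have a: "a > 0" and b: "b > 0" and t: "min a b > 0"
        using elim p by auto
      \<comment> \<open>\<open>anti\<close> compares the denominators at the two parameter pairs,
        and \<open>ge\<close> keeps the smaller one positive, as the local \<open>log_mono\<close>
        requires.\<close>
      have "AE \<omega> in M. log 2 (1 + w * g (min a b) (min a b) \<omega>) \<le> log 2 (1 + w * g a b \<omega>)"
        using hg[OF a b] hg[OF t t] ge[OF a b] anti[OF t min.cobounded1 t min.cobounded2]
      proof eventually_elim
        case (elim \<omega>)
        then show ?case
          using L log_mono[of "D a b \<omega>" "D (min a b) (min a b) \<omega>"] by (simp add: h_def)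
      qed
      then show ?case
        unfolding p ergodic_capacity_def using int[OF a b] int[OF t t]
        by (auto intro: integral_mono_AE)
    qed
    show "\<forall>\<^sub>F p in at_top \<times>\<^sub>F at_top. (case p of (a, b) \<Rightarrow> ergodic_capacity M w (g a b)) \<le> c"
      using pos
    proof eventually_elim
      case (elim p)
      obtain a b where p: "p = (a, b)"
        by (cases p)
      have a: "a > 0" and b: "b > 0"
        using elim p by auto
      have "AE \<omega> in M. log 2 (1 + w * g a b \<omega>) \<le> c"
        using hg[OF a b] bound[OF a b] by eventually_elim auto
      then have "ergodic_capacity M w (g a b) \<le> (LINT \<omega>|M. c)"
        unfolding ergodic_capacity_def using int[OF a b] by (intro integral_mono_AE) auto
      then show ?case
        by (simp add: p prob_space)
    qed
  qed
qed

theorem corollary1: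
  fixes M :: "'a measure" and X Z :: "'a \<Rightarrow> real"
    and \<kappa>\<^sub>1 \<kappa>\<^sub>2 varpi :: real and R :: relaying
  assumes "prob_space M"
    and "prob_space.indep_var M borel X borel Z"
    and "AE \<omega> in M. X \<omega> > 0" and "AE \<omega> in M. Z \<omega> > 0"
    and "integrable M X"
    and "\<kappa>\<^sub>1 \<ge> 0" and "\<kappa>\<^sub>2 \<ge> 0" and "\<not> (\<kappa>\<^sub>1 = 0 \<and> \<kappa>\<^sub>2 = 0)"
    and "varpi > 0"
  shows "(\<forall>\<mu>\<^sub>1>0. \<forall>\<mu>\<^sub>r>0. integrable M
        (\<lambda>\<omega>. log 2 (1 + varpi * sndr R M \<kappa>\<^sub>1 \<kappa>\<^sub>2 (\<lambda>\<omega>. \<mu>\<^sub>1 * X \<omega>) (\<lambda>\<omega>. \<mu>\<^sub>r * Z \<omega>) \<omega>))) \<and>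
    ((\<lambda>(\<mu>\<^sub>1, \<mu>\<^sub>r).
        ergodic_capacity M varpi (sndr R M \<kappa>\<^sub>1 \<kappa>\<^sub>2 (\<lambda>\<omega>. \<mu>\<^sub>1 * X \<omega>) (\<lambda>\<omega>. \<mu>\<^sub>r * Z \<omega>)))
      \<longlongrightarrow> capacity_ceiling R varpi \<kappa>\<^sub>1 \<kappa>\<^sub>2) (at_top \<times>\<^sub>F at_top)"
proof -
  interpret prob_space M by fact
  have [measurable]: "X \<in> borel_measurable M" "Z \<in> borel_measurable M"
    using indep_var_rv1[OF assms(2)] indep_var_rv2[OF assms(2)] by auto
  define L where "L = (case R of AF \<Rightarrow> \<kappa>\<^sub>1\<^sup>2 + \<kappa>\<^sub>2\<^sup>2 + \<kappa>\<^sub>1\<^sup>2 * \<kappa>\<^sub>2\<^sup>2 | DF \<Rightarrow> max (\<kappa>\<^sub>1\<^sup>2) (\<kappa>\<^sub>2\<^sup>2))"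
  define m where "m = (LINT \<omega>|M. X \<omega>)"
  \<comment> \<open>For AF, numerator and denominator are divided by the product of the hop SNRs.
    The constant C grows with \<open>a\<close>, but this factor cancels and leaves a term that
    vanishes as \<open>b\<close> grows. For DF, the minimum of the two fractions becomes the
    reciprocal of a maximum.\<close>
  define D where "D a b \<omega> = (case R of
      AF \<Rightarrow> L + (1 + \<kappa>\<^sub>2\<^sup>2) / (a * X \<omega>) + m * (1 + \<kappa>\<^sub>1\<^sup>2) / (b * (X \<omega> * Z \<omega>)) + 1 / (a * b * (X \<omega> * Z \<omega>))
    | DF \<Rightarrow> max (\<kappa>\<^sub>1\<^sup>2 + 1 / (a * X \<omega>)) (\<kappa>\<^sub>2\<^sup>2 + 1 / (b * Z \<omega>)))" for a b \<omega>
  define g where "g a b = sndr R M \<kappa>\<^sub>1 \<kappa>\<^sub>2 (\<lambda>\<omega>. a * X \<omega>) (\<lambda>\<omega>. b * Z \<omega>)" for a b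
  have "\<kappa>\<^sub>1\<^sup>2 > 0 \<or> \<kappa>\<^sub>2\<^sup>2 > 0"
    using assms(8) by auto
  then have L: "L > 0"
    by (cases R) (auto simp: L_def less_max_iff_disj add_pos_nonneg add_nonneg_pos)
  \<comment> \<open>The sign of \<open>m\<close> makes the third AF term nonnegative and decreasing
    in \<open>b\<close>.\<close>
  have m: "m \<ge> 0"
    unfolding m_def by (rule integral_nonneg_AE) (use assms(3) in eventually_elim, simp)
  \<comment> \<open>The equations of \<open>sndr\<close> rewrite only when the sample point is
    supplied; \<open>measurable_cong\<close> lifts them to the unapplied function.\<close>
  have meas: "g a b \<in> borel_measurable M" for a b
    unfolding g_def
    by (cases R) (simp_all add: measurable_cong[OF sndr.simps(1)] measurable_cong[OF sndr.simps(2)] Let_def)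
  have gD: "AE \<omega> in M. g a b \<omega> = 1 / D a b \<omega>" if "a > 0" "b > 0" for a b
    using assms(3,4)
  proof eventually_elim
    case (elim \<omega>)
    show ?case
    proof (cases R)
      case AF
      \<comment> \<open>Over the common denominator,
        \<open>a * m * (1 + \<kappa>\<^sub>1\<^sup>2) + 1\<close> is the constant C, since
        \<open>a * m\<close> is the mean of the first hop SNR.\<close>
      have "D a b \<omega> = (L * (a * X \<omega>) * (b * Z \<omega>) + (1 + \<kappa>\<^sub>2\<^sup>2) * (b * Z \<omega>) + (a * m * (1 + \<kappa>\<^sub>1\<^sup>2) + 1))
              / ((a * X \<omega>) * (b * Z \<omega>))"
        using that elim by (simp add: AF D_def divide_simps) (simp add: algebra_simps)
      then show ?thesis
        by (simp add: g_def AF L_def m_def)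
    next
      case DF
      have 1: "a * X \<omega> / (\<kappa>\<^sub>1\<^sup>2 * (a * X \<omega>) + 1) = 1 / (\<kappa>\<^sub>1\<^sup>2 + 1 / (a * X \<omega>))"
        using that elim by (simp add: divide_simps)
      have 2: "b * Z \<omega> / (\<kappa>\<^sub>2\<^sup>2 * (b * Z \<omega>) + 1) = 1 / (\<kappa>\<^sub>2\<^sup>2 + 1 / (b * Z \<omega>))"
        using that elim by (simp add: divide_simps)
      have inv: "min (1 / u) (1 / v) = 1 / max u v" if "u > 0" "v > 0" for u v :: real
        using that by (auto simp: min_def max_def divide_simps)
      show ?thesis
        unfolding g_def DF sndr.simps 1 2 D_def relaying.case
        using that elim by (intro inv add_nonneg_pos) auto
    qed
  qed
  have ge: "AE \<omega> in M. L \<le> D a b \<omega>" if "a > 0" "b > 0" for a b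
    using assms(3,4)
  proof eventually_elim
    case (elim \<omega>)
    show ?case
    proof (cases R)
      case AF
      have "0 \<le> (1 + \<kappa>\<^sub>2\<^sup>2) / (a * X \<omega>)" "0 \<le> m * (1 + \<kappa>\<^sub>1\<^sup>2) / (b * (X \<omega> * Z \<omega>))"
           "0 \<le> 1 / (a * b * (X \<omega> * Z \<omega>))"
        using that elim m by auto
      then show ?thesis
        by (simp add: AF D_def)
    next
      case DF
      show ?thesis
        unfolding D_def L_def DF relaying.case using that elim by (intro max.mono) auto
    qed
  qed
  have anti: "AE \<omega> in M. D a' b' \<omega> \<le> D a b \<omega>" if "0 < a" "a \<le> a'" "0 < b" "b \<le> b'" for a b a' b'
    using assms(3,4)
  proof eventually_elim
    case (elim \<omega>)
    show ?case
    proof (cases R)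
      case AF
      then show ?thesis
        using that elim m unfolding D_def
        by (auto intro!: add_mono divide_left_mono mult_right_mono mult_mono mult_pos_pos)
    next
      case DF
      have "1 / (a' * X \<omega>) \<le> 1 / (a * X \<omega>)" "1 / (b' * Z \<omega>) \<le> 1 / (b * Z \<omega>)"
        using that elim by (auto intro!: divide_left_mono mult_right_mono mult_pos_pos)
      then show ?thesis
        unfolding D_def DF relaying.case by (intro max.mono add_left_mono)
    qed
  qed
  have lim: "AE \<omega> in M. ((\<lambda>t. D t t \<omega>) \<longlongrightarrow> L) at_top"
    using assms(3,4)
  proof eventually_elim
    case (elim \<omega>)
    \<comment> \<open>With the sample point fixed, every varying term of \<open>D\<close> on the
      diagonal has one of these two shapes, where \<open>d\<close> is a fading value or the product
      of both.\<close>
    have vanish: "((\<lambda>t. c / (t * d)) \<longlongrightarrow> 0) at_top" if "d > 0" for c d :: real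
      using that by real_asymp
    have vanish2: "((\<lambda>t. c / (t * t * d)) \<longlongrightarrow> 0) at_top" if "d > 0" for c d :: real
      using that by real_asymp
    show ?case
    proof (cases R)
      case AF
      \<comment> \<open>The zeros stay in the limit so that \<open>tendsto_add\<close> matches it
        summand by summand.\<close>
      have "((\<lambda>t. D t t \<omega>) \<longlongrightarrow> L + 0 + 0 + 0) at_top"
        unfolding D_def AF relaying.case using elim
        by (intro tendsto_add tendsto_const vanish vanish2 mult_pos_pos)
      then show ?thesis
        by simp
    next
      case DF
      have "((\<lambda>t. D t t \<omega>) \<longlongrightarrow> max (\<kappa>\<^sub>1\<^sup>2 + 0) (\<kappa>\<^sub>2\<^sup>2 + 0)) at_top"
        unfolding D_def DF relaying.case using elim
        by (intro tendsto_max tendsto_add tendsto_const vanish)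
      then show ?thesis
        by (simp add: DF L_def)
    qed
  qed
  have "capacity_ceiling R varpi \<kappa>\<^sub>1 \<kappa>\<^sub>2 = log 2 (1 + varpi * (1 / L))"
    by (cases R) (simp_all add: capacity_ceiling_def L_def)
  then show ?thesis
    using ergodic_capacity_tendsto_ceiling[where g = g and D = D, OF assms(1,9) L meas gD ge anti lim]
    by (simp add: g_def)
qed

end
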